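(* Let $\xi_+>0$ and let $$D_1(x)=\frac12\,\frac{\Sigma_1^2}{2x},\qquad D_2(x)=\frac{\overline{\delta\beta^{(2)}}}{2x}+\frac{\overline{\delta\beta^{(4)}}}{4x^2},\qquad x\ge\xi_+ ,$$ with the constants $\Sigma_1^2,\overline{\delta\beta^{(2)}},\overline{\delta\beta^{(4)}},k_{scatt}^2, C$ given in the context. Consider the Fokker-Planck equation on $[\xi_+,+\infty)$ with reflection at $\xi_+$, $$\partial_\tau\rho(x,\tau)=-\partial_xJ(x,\tau),\qquad J(\xi_+,\tau)=0\ \ \forall\tau>0,\qquad J(x,\tau)=-\partial_x\big(D_1(x)\rho(x,\tau)\big)+D_2(x)\rho(x,\tau).$$ Then its stationary probability density is $$\rho_{eq}(x)=\mathcal N(\xi_+)\,x^{1+\frac{\overline{\delta\beta^{(4)}}}{\Sigma_1^2}}\exp\left(\frac{2\,\overline{\delta\beta^{(2)}}}{\Sigma_1^2}\,x\right)=\mathcal N(\xi_+)\,x^{\frac{d-1}2+\frac{C}{k_{scatt}^2}}\exp\left(-\frac{x}{k_{scatt}^2}\right),\qquad x\ge\xi_+,$$ with $\mathcal N(\xi_+)$ a normalisation constant. Consequently, under the change of variable $x=\|p\|^2/2$, the corresponding density of $\|p\|$ (with respect to the number of collisions) is $$\widetilde{\mathcal N}(\xi_+)\,\|p\|^{d+\frac{2C}{k_{scatt}^2}}\exp\left(-\frac{\|p\|^2}{2k_{scatt}^2}\right),$$ and the probability density of $\|p\|$ with respect to time, obtained from the latter by weighting with the mean time $\ell_*/\|p\|$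 between two collisions and renormalising, is $$\mathcal N'(\xi_+)\,\|p\|^{d-1+\frac{2C}{k_{scatt}^2}}\exp\left(-\frac{\|p\|^2}{2k_{scatt}^2}\right),$$ where $\widetilde{\mathcal N}(\xi_+)$ and $\mathcal N'(\xi_+)$ are normalisation constants depending on $\xi_+$, and $\|p\|\ge\sqrt{2\xi_+}$.
   Context: Let $d\ge2$, $M>0$, $\ell_*>0$; let $\sigma:\mathbb R^d\to\mathbb R$ be rotationally invariant with compact support in $B(0,1/2)$ and $\|\sigma\|_\infty\le1$; let $U\in C^\infty(\mathbb R)$ be confining with $U(Q)\sim|Q|^r$, $r\ge1$. The variables $(Q,P)\in\mathbb R^2$ have a compactly supported probability density $\rho(Q,P)=\hat\rho\big(\frac{P^2}{2M}+U(Q)\big)$, and $b$ is uniform in the $(d-1)$-dimensional ball $\{\|b\|\le1/2,\ b\cdot e=0\}$, independent of $(Q,P)$, where $e$ is a unit vector ($e=p/\|p\|$). A bar denotes expectation over $(b,Q,P)$. Set $$L_0(\mu,\|b\|)=\int_0^\mu\sigma(b+(\lambda-\tfrac12)e)\,d\lambda,\quad L_0=L_0(1,\|b\|),\quad K_0(\mu,\|b\|)=\int_0^\mu L_0(\lambda,\|b\|)\,d\lambda,$$ $$k_{scatt}^2=\frac{\overline{P^2}}{M},\qquad \Sigma_1^2=\frac{\overline{P^2}}{M}\,\overline{L_0^2}\ (>0),\qquad \overline{\delta\beta^{(2)}}=-\frac{\overline{L_0^2}}{2},$$ $$\overline{\delta\beta^{(4)}}=\Sigma_1^2\left(\frac{d-3}{2}+\frac{M\overline{U''}}{\overline{P^2}}\,\frac{\overline{\int_0^1d\lambda\int_0^\lambda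 d\lambda'\,K_0(\lambda',\|b\|)\,\sigma(b+\lambda'e)}}{\overline{L_0^2}}\right),$$ $$C=\overline{U''}\,\frac{\overline{\int_0^1d\lambda\int_0^\lambda d\lambda'\,K_0(\lambda',\|b\|)\,\sigma(b+\lambda'e)}}{\overline{L_0^2}}.$$ A stationary density is a probability density $\rho_{eq}$ on $[\xi_+,\infty)$, independent of $\tau$, solving the equation together with the boundary condition. *)

theory Defs
  imports "HOL-Probability.Probability" "HOL-Library.Landau_Symbols"
begin

definition smooth_fun :: "(real \<Rightarrow> real) \<Rightarrow> bool" where
  "smooth_fun U \<longleftrightarrow> (\<forall>n x. (deriv ^^ n) U field_differentiable at x)"

definition rotation_invariant :: "(real ^ 'n \<Rightarrow> real) \<Rightarrow> bool" where
  "rotation_invariant \<sigma> \<longleftrightarrow> (\<forall>A x. rotation_matrix A \<longrightarrow> \<sigma> (A *v x) = \<sigma> x)"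

definition prob_density_on :: "real set \<Rightarrow> (real \<Rightarrow> real) \<Rightarrow> bool" where
  "prob_density_on S f \<longleftrightarrow>
     (\<forall>x\<in>S. 0 \<le> f x) \<and> set_integrable lborel S f \<and> (LBINT x:S. f x) = 1"

definition orthonormal_basis_of :: "'a::euclidean_space set \<Rightarrow> 'a set \<Rightarrow> bool" where
  "orthonormal_basis_of V B \<longleftrightarrow>
     pairwise orthogonal B \<and> (\<forall>v\<in>B. norm v = 1) \<and> span B = V"

lemma orthonormal_basis_of_hyperplane:
  "\<exists>B. orthonormal_basis_of {v. v \<bullet> e = 0} B"
proof -
  have "subspace {v. v \<bullet> e = 0}"
    by (rule subspace_hyperplane2)
  then obtain B where "pairwise orthogonal B" "\<And>x. x \<in> B \<Longrightarrow> norm x = 1"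
    "span B = {v. v \<bullet> e = 0}"
    by (rule orthonormal_basis_subspace) blast
  then show ?thesis
    unfolding orthonormal_basis_of_def by blast
qed

text \<open>
  Lebesgue measure of dimension \<open>d - 1\<close> on the hyperplane orthogonal to \<open>e\<close>, as a Borel measure on
  the ambient space. It is built from coordinates in an orthonormal basis of the hyperplane, just as
  \<^const>\<open>lborel\<close> is built from \<^const>\<open>Basis\<close>; it does not depend on the basis chosen.
\<close>
definition hyperplane_lborel :: "'a::euclidean_space \<Rightarrow> 'a measure" where
  "hyperplane_lborel e =
     (let B = (SOME B. orthonormal_basis_of {v. v \<bullet> e = 0} B)
      in distr (Pi\<^sub>M B (\<lambda>_. lborel)) borel (\<lambda>f. \<Sum>v\<in>B. f v *\<^sub>R v))"

definition impact_law :: "real ^ 'n \<Rightarrow> (real ^ 'n) measure" where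
  "impact_law e = uniform_measure (hyperplane_lborel e) {b. norm b \<le> 1/2 \<and> b \<bullet> e = 0}"

definition bath_density :: "real \<Rightarrow> (real \<Rightarrow> real) \<Rightarrow> (real \<Rightarrow> real) \<Rightarrow> real \<times> real \<Rightarrow> real" where
  "bath_density M U \<rho>hat = (\<lambda>(Q, P). \<rho>hat (P\<^sup>2 / (2 * M) + U Q))"

definition bath_law :: "real \<Rightarrow> (real \<Rightarrow> real) \<Rightarrow> (real \<Rightarrow> real) \<Rightarrow> (real \<times> real) measure" where
  "bath_law M U \<rho>hat = density lborel (\<lambda>qp. ennreal (bath_density M U \<rho>hat qp))"

text \<open>The expectation over \<open>(b, Q, P)\<close> that is written as a bar.\<close>
definition bar ::
  "real ^ 'n \<Rightarrow> real \<Rightarrow> (real \<Rightarrow> real) \<Rightarrow> (real \<Rightarrow> real) \<Rightarrow> (real ^ 'n \<Rightarrow> real \<Rightarrow> real \<Rightarrow> real) \<Rightarrow> real"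
where
  "bar e M U \<rho>hat f = (\<integral>(b, Q, P). f b Q P \<partial>(impact_law e \<Otimes>\<^sub>M bath_law M U \<rho>hat))"

text \<open>
  For rotationally invariant \<open>\<sigma>\<close> and \<open>b\<close> orthogonal to \<open>e\<close> the following integrals depend on \<open>b\<close>
  only through its norm; they are given the vector \<open>b\<close> as argument.
\<close>
definition L0 :: "(real ^ 'n \<Rightarrow> real) \<Rightarrow> real ^ 'n \<Rightarrow> real \<Rightarrow> real ^ 'n \<Rightarrow> real" where
  "L0 \<sigma> e \<mu> b = (LBINT l:{0..\<mu>}. \<sigma> (b + (l - 1/2) *\<^sub>R e))"

definition K0 :: "(real ^ 'n \<Rightarrow> real) \<Rightarrow> real ^ 'n \<Rightarrow> real \<Rightarrow> real ^ 'n \<Rightarrow> real" where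
  "K0 \<sigma> e \<mu> b = (LBINT l:{0..\<mu>}. L0 \<sigma> e l b)"

definition double_int :: "(real ^ 'n \<Rightarrow> real) \<Rightarrow> real ^ 'n \<Rightarrow> real ^ 'n \<Rightarrow> real" where
  "double_int \<sigma> e b = (LBINT l:{0..1}. (LBINT l':{0..l}. K0 \<sigma> e l' b * \<sigma> (b + l' *\<^sub>R e)))"

definition mean_P2 :: "(real ^ 'n) \<Rightarrow> real \<Rightarrow> (real \<Rightarrow> real) \<Rightarrow> (real \<Rightarrow> real) \<Rightarrow> real" where
  "mean_P2 e M U \<rho>hat = bar e M U \<rho>hat (\<lambda>b Q P. P\<^sup>2)"

definition mean_U2 :: "(real ^ 'n) \<Rightarrow> real \<Rightarrow> (real \<Rightarrow> real) \<Rightarrow> (real \<Rightarrow> real) \<Rightarrow> real" where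
  "mean_U2 e M U \<rho>hat = bar e M U \<rho>hat (\<lambda>b Q P. deriv (deriv U) Q)"

definition mean_L02 ::
  "(real ^ 'n \<Rightarrow> real) \<Rightarrow> real ^ 'n \<Rightarrow> real \<Rightarrow> (real \<Rightarrow> real) \<Rightarrow> (real \<Rightarrow> real) \<Rightarrow> real" where
  "mean_L02 \<sigma> e M U \<rho>hat = bar e M U \<rho>hat (\<lambda>b Q P. (L0 \<sigma> e 1 b)\<^sup>2)"

definition mean_double_int ::
  "(real ^ 'n \<Rightarrow> real) \<Rightarrow> real ^ 'n \<Rightarrow> real \<Rightarrow> (real \<Rightarrow> real) \<Rightarrow> (real \<Rightarrow> real) \<Rightarrow> real" where
  "mean_double_int \<sigma> e M U \<rho>hat = bar e M U \<rho>hat (\<lambda>b Q P. double_int \<sigma> e b)"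

definition kscatt_sq :: "real ^ 'n \<Rightarrow> real \<Rightarrow> (real \<Rightarrow> real) \<Rightarrow> (real \<Rightarrow> real) \<Rightarrow> real" where
  "kscatt_sq e M U \<rho>hat = mean_P2 e M U \<rho>hat / M"

definition Sigma1_sq ::
  "(real ^ 'n \<Rightarrow> real) \<Rightarrow> real ^ 'n \<Rightarrow> real \<Rightarrow> (real \<Rightarrow> real) \<Rightarrow> (real \<Rightarrow> real) \<Rightarrow> real" where
  "Sigma1_sq \<sigma> e M U \<rho>hat = mean_P2 e M U \<rho>hat / M * mean_L02 \<sigma> e M U \<rho>hat"

definition delta_beta2 ::
  "(real ^ 'n \<Rightarrow> real) \<Rightarrow> real ^ 'n \<Rightarrow> real \<Rightarrow> (real \<Rightarrow> real) \<Rightarrow> (real \<Rightarrow> real) \<Rightarrow> real" where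
  "delta_beta2 \<sigma> e M U \<rho>hat = - mean_L02 \<sigma> e M U \<rho>hat / 2"

definition delta_beta4 ::
  "(real ^ 'n \<Rightarrow> real) \<Rightarrow> real ^ 'n \<Rightarrow> real \<Rightarrow> (real \<Rightarrow> real) \<Rightarrow> (real \<Rightarrow> real) \<Rightarrow> real" where
  "delta_beta4 \<sigma> e M U \<rho>hat =
     Sigma1_sq \<sigma> e M U \<rho>hat *
       ((real CARD('n) - 3) / 2 +
        M * mean_U2 e M U \<rho>hat / mean_P2 e M U \<rho>hat *
          (mean_double_int \<sigma> e M U \<rho>hat / mean_L02 \<sigma> e M U \<rho>hat))"

definition C_const ::
  "(real ^ 'n \<Rightarrow> real) \<Rightarrow> real ^ 'n \<Rightarrow> real \<Rightarrow> (real \<Rightarrow> real) \<Rightarrow> (real \<Rightarrow> real) \<Rightarrow> real" where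
  "C_const \<sigma> e M U \<rho>hat =
     mean_U2 e M U \<rho>hat * (mean_double_int \<sigma> e M U \<rho>hat / mean_L02 \<sigma> e M U \<rho>hat)"

text \<open>
  Spatial derivatives are taken within \<open>[\<xi>, \<infinity>)\<close>, hence are one-sided at \<open>\<xi>\<close>.
\<close>
definition flux ::
  "(real \<Rightarrow> real) \<Rightarrow> (real \<Rightarrow> real) \<Rightarrow> real \<Rightarrow> (real \<Rightarrow> real \<Rightarrow> real) \<Rightarrow> real \<Rightarrow> real \<Rightarrow> real" where
  "flux D1 D2 \<xi> \<rho> x \<tau> =
     - vector_derivative (\<lambda>y. D1 y * \<rho> y \<tau>) (at x within {\<xi>..}) + D2 x * \<rho> x \<tau>"

definition solves_fokker_planck ::
  "(real \<Rightarrow> real) \<Rightarrow> (real \<Rightarrow> real) \<Rightarrow> real \<Rightarrow> (real \<Rightarrow> real \<Rightarrow> real) \<Rightarrow> bool" where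
  "solves_fokker_planck D1 D2 \<xi> \<rho> \<longleftrightarrow>
     (\<forall>\<tau>>0.
        (\<forall>x\<ge>\<xi>. (\<lambda>y. D1 y * \<rho> y \<tau>) differentiable (at x within {\<xi>..}) \<and>
               (\<lambda>y. flux D1 D2 \<xi> \<rho> y \<tau>) differentiable (at x within {\<xi>..}) \<and>
               ((\<lambda>t. \<rho> x t) has_vector_derivative
                  - vector_derivative (\<lambda>y. flux D1 D2 \<xi> \<rho> y \<tau>) (at x within {\<xi>..})) (at \<tau>)) \<and>
        flux D1 D2 \<xi> \<rho> \<xi> \<tau> = 0)"

definition stationary_density ::
  "(real \<Rightarrow> real) \<Rightarrow> (real \<Rightarrow> real) \<Rightarrow> real \<Rightarrow> (real \<Rightarrow> real) \<Rightarrow> bool" where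
  "stationary_density D1 D2 \<xi> \<rho> \<longleftrightarrow>
     prob_density_on {\<xi>..} \<rho> \<and> solves_fokker_planck D1 D2 \<xi> (\<lambda>x \<tau>. \<rho> x)"

text \<open>
  Passage from a density \<open>f\<close> of the speed on \<open>[a, \<infinity>)\<close> per collision to the density per unit time:
  weight by the mean time \<open>lstar / r\<close> between collisions at speed \<open>r\<close> and renormalise.
\<close>
definition time_density :: "real \<Rightarrow> real \<Rightarrow> (real \<Rightarrow> real) \<Rightarrow> real \<Rightarrow> real" where
  "time_density lstar a f r = (lstar / r * f r) / (LBINT s:{a..}. lstar / s * f s)"

end

theory Submission
  imports Defs "HOL-Real_Asymp.Real_Asymp"
begin

text \<open>
  In a stationary state the flux is constant in \<open>x\<close>, hence zero by reflection. The resulting linear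
  equation \<open>(D1 \<rho>)' = D2 \<rho>\<close> has a one-dimensional solution space, in which the normalisation singles out
  one element. The density of the speed follows by the substitution \<open>x = s\<^sup>2/2\<close>, \<open>dx = s ds\<close>; weighting
  with \<open>1/s\<close> lowers the exponent by one.
\<close>

section \<open>Probability densities and integrals on half-lines\<close>

text \<open>Integrability and total mass one merge into a single equation between nonnegative
  integrals, the form in which the change of variable below is proved.\<close>

lemma prob_density_on_iff_nn_integral:
  assumes "f \<in> borel_measurable borel" "S \<in> sets borel" "\<And>x. x \<in> S \<Longrightarrow> 0 \<le> f x"
  shows "prob_density_on S f \<longleftrightarrow> (\<integral>\<^sup>+x. ennreal (indicator S x * f x) \<partial>lborel) = 1"
proof -
  have meas: "(\<lambda>x. indicator S x * f x) \<in> borel_measurable lborel"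
    using assms(1,2) by simp
  have nonneg: "0 \<le> indicator S x * f x" for x
    using assms(3) by (simp add: indicator_def)
  show ?thesis
    using assms(3) nn_integral_eq_integrable[OF meas, of 1] nonneg
    by (auto simp: prob_density_on_def set_integrable_def set_lebesgue_integral_def)
qed

lemma prob_density_on_cong:
  assumes "S \<in> sets borel" "\<And>x. x \<in> S \<Longrightarrow> f x = g x"
  shows "prob_density_on S f \<longleftrightarrow> prob_density_on S g"
proof -
  have "(LBINT x:S. f x) = (LBINT x:S. g x)"
    using assms by (intro set_lebesgue_integral_cong) auto
  moreover have "set_integrable lborel S f \<longleftrightarrow> set_integrable lborel S g"
    using assms(2) by (intro set_integrable_cong) auto
  ultimately show ?thesis
    using assms(2) by (simp add: prob_density_on_def)
qed

text \<open>Were the integral zero, the nonnegative integrand would vanish almost everywhere, making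
  \<open>{a..a+1}\<close> a null set. Used for the normalising integrals, by which later steps
  divide.\<close>

lemma set_integral_pos_atLeast:
  fixes f :: "real \<Rightarrow> real"
  assumes "set_integrable lborel {a..} f" "\<And>x. a \<le> x \<Longrightarrow> 0 < f x"
  shows "0 < (LBINT x:{a..}. f x)"
proof -
  have int: "integrable lborel (\<lambda>x. indicator {a..} x *\<^sub>R f x)"
    using assms(1) by (simp add: set_integrable_def)
  have nonneg: "0 \<le> indicator {a..} x *\<^sub>R f x" for x
    using assms(2)[of x] by (auto simp: indicator_def less_imp_le)
  have "\<not> (AE x in lborel. indicator {a..} x *\<^sub>R f x = 0)"
  proof
    assume "AE x in lborel. indicator {a..} x *\<^sub>R f x = 0"
    then have "AE x in lborel. x \<notin> {a..a+1}"
      by eventually_elim (use assms(2) in \<open>force simp: indicator_def split: if_splits\<close>)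
    then have "emeasure lborel {a..a+1} = 0"
      by (subst (asm) AE_iff_measurable[where N="{a..a+1}"]) auto
    then show False by simp
  qed
  then have "(LBINT x:{a..}. f x) \<noteq> 0"
    unfolding set_lebesgue_integral_def
    using integral_nonneg_eq_0_iff_AE[OF int] nonneg by blast
  moreover have "0 \<le> (LBINT x:{a..}. f x)"
    unfolding set_lebesgue_integral_def by (rule integral_nonneg_AE) (use nonneg in simp)
  ultimately show ?thesis by simp
qed

lemma set_integrable_exp_atLeast:
  fixes a \<xi> :: real
  assumes "a < 0"
  shows "set_integrable lborel {\<xi>..} (\<lambda>x. exp (a * x))"
proof -
  \<comment> \<open>The \<open>0\<close> is the limit at infinity of the antiderivative
    \<open>exp (a * x) / a\<close>; it relies on \<open>a < 0\<close>.\<close>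
  have "(\<integral>\<^sup>+x. ennreal (exp (a * x)) * indicator {\<xi>..} x \<partial>lborel) = 0 - exp (a * \<xi>) / a"
    using assms
    by (intro nn_integral_FTC_atLeast[where F="\<lambda>x. exp (a * x) / a"])
       (auto intro!: derivative_eq_intros, real_asymp)
  moreover have "ennreal (exp (a * x)) * indicator {\<xi>..} x = ennreal (indicator {\<xi>..} x *\<^sub>R exp (a * x))" for x
    by (simp add: indicator_def)
  ultimately show ?thesis
    unfolding set_integrable_def by (intro integrableI_nonneg) auto
qed

text \<open>The exponential is split into two factors \<open>exp (a/2 * x)\<close>: one keeps the
  power bounded on the half-line, the other is an integrable majorant.\<close>

lemma set_integrable_powr_exp_atLeast:
  fixes a p \<xi> :: real
  assumes "a < 0" "\<xi> > 0"
  shows "set_integrable lborel {\<xi>..} (\<lambda>x. x powr p * exp (a * x))"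
proof -
  have "((\<lambda>x. x powr p * exp (a/2 * x)) \<longlongrightarrow> 0) at_top"
    using assms(1) by real_asymp
  from tendstoD[OF this zero_less_one]
  have "eventually (\<lambda>x. norm (x powr p * exp (a/2 * x)) < 1) at_top"
    by (simp add: dist_real_def)
  then obtain X where X: "\<And>x. x \<ge> X \<Longrightarrow> norm (x powr p * exp (a/2 * x)) < 1"
    by (auto simp: eventually_at_top_linorder)
  \<comment> \<open>Below the threshold \<open>X\<close> the bound comes from compactness;
    \<open>\<xi> > 0\<close> keeps the power away from its singularity at zero.\<close>
  have "continuous_on {\<xi>..X} (\<lambda>x. x powr p * exp (a/2 * x))"
    using assms(2) by (intro continuous_intros) auto
  then have "bounded ((\<lambda>x. x powr p * exp (a/2 * x)) ` {\<xi>..X})"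
    by (intro compact_imp_bounded compact_continuous_image) auto
  then obtain B where B: "\<And>x. x \<in> {\<xi>..X} \<Longrightarrow> norm (x powr p * exp (a/2 * x)) \<le> B"
    unfolding bounded_iff by blast
  have bound: "norm (x powr p * exp (a/2 * x)) \<le> max B 1" if "x \<ge> \<xi>" for x
    using X[of x] B[of x] that by (cases "x \<le> X") auto
  have "set_integrable lborel {\<xi>..} (\<lambda>x. max B 1 * exp (a/2 * x))"
    using assms(1) by (intro set_integrable_mult_right set_integrable_exp_atLeast) auto
  then show ?thesis
  proof (rule set_integrable_bound)
    show "set_borel_measurable lborel {\<xi>..} (\<lambda>x. x powr p * exp (a * x))"
      unfolding set_borel_measurable_def by measurable
    have "norm (x powr p * exp (a * x)) \<le> norm (max B 1 * exp (a/2 * x))" if "x \<ge> \<xi>" for x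
    proof -
      have "exp (a * x) = exp (a/2 * x) * exp (a/2 * x)"
        by (simp flip: exp_add)
      then have "norm (x powr p * exp (a * x)) = norm (x powr p * exp (a/2 * x)) * exp (a/2 * x)"
        by (simp add: abs_mult)
      also have "\<dots> \<le> max B 1 * exp (a/2 * x)"
        using bound[OF that] by (intro mult_right_mono) auto
      also have "\<dots> \<le> norm (max B 1 * exp (a/2 * x))" by simp
      finally show ?thesis .
    qed
    then show "AE x in lborel. x \<in> {\<xi>..} \<longrightarrow>
        norm (x powr p * exp (a * x)) \<le> norm (max B 1 * exp (a/2 * x))"
      by auto
  qed
qed

section \<open>The stationary equation as a linear first-order equation\<close>

text \<open>Non-triviality of this filter makes derivatives within the half-line unique, also at the
  end point, so that \<open>vector_derivative\<close> can be evaluated there. The one-sided filter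
  from the right already lies below it.\<close>

lemma at_within_atLeast_neq_bot:
  fixes x \<xi> :: real
  assumes "x \<ge> \<xi>"
  shows "at x within {\<xi>..} \<noteq> bot"
proof -
  have "at x within {x..} \<noteq> bot"
    by (simp add: at_within_Ici_at_right)
  moreover have "at x within {x..} \<le> at x within {\<xi>..}"
    using assms by (intro at_le) auto
  ultimately show ?thesis using bot.extremum_uniqueI by metis
qed

text \<open>\<open>flux\<close> is built from the operator \<open>vector_derivative\<close>, which
  is informative only together with differentiability. The right-hand side packs both into one
  differential equation that can be integrated explicitly.\<close>

lemma stationary_solution_iff_zero_flux:
  fixes \<xi> :: real
  shows "solves_fokker_planck D1 D2 \<xi> (\<lambda>x \<tau>. \<rho> x) \<longleftrightarrow>
     (\<forall>x\<ge>\<xi>. ((\<lambda>y. D1 y * \<rho> y) has_real_derivative D2 x * \<rho> x) (at x within {\<xi>..}))"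
    (is "?L \<longleftrightarrow> ?R")
proof
  \<comment> \<open>For a time-independent \<open>\<rho>\<close> the flux is the same at all times;
    the time \<open>1\<close> is an arbitrary positive representative.\<close>
  let ?J = "\<lambda>y. flux D1 D2 \<xi> (\<lambda>x \<tau>. \<rho> x) y 1"
  assume L: ?L
  have "(?J has_real_derivative 0) (at x within {\<xi>..})" if "x \<in> {\<xi>..}" for x
  proof -
    have diff: "?J differentiable (at x within {\<xi>..})"
      and "((\<lambda>t::real. \<rho> x) has_vector_derivative
              - vector_derivative ?J (at x within {\<xi>..})) (at 1)"
      using L that by (auto simp: solves_fokker_planck_def)
    \<comment> \<open>The left side of the equation is the time derivative of a constant, and a
      two-sided derivative is unique.\<close>
    then have "vector_derivative ?J (at x within {\<xi>..}) = 0"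
      using vector_derivative_unique_at[OF has_vector_derivative_const] by fastforce
    with diff show ?thesis
      by (simp add: vector_derivative_works has_real_derivative_iff_has_vector_derivative)
  qed
  \<comment> \<open>The half-line is convex, so a derivative vanishing within it, one-sided at
    \<open>\<xi>\<close>, forces a constant.\<close>
  then obtain c where c: "\<forall>x\<in>{\<xi>..}. ?J x = c"
    using has_field_derivative_zero_constant[of "{\<xi>..}" ?J] by auto
  moreover have "?J \<xi> = 0"
    using L by (simp add: solves_fokker_planck_def)
  ultimately have zero: "?J x = 0" if "x \<ge> \<xi>" for x
    using that by (metis atLeast_iff order_refl)
  show ?R
  proof (intro allI impI)
    fix x assume x: "x \<ge> \<xi>"
    have "(\<lambda>y. D1 y * \<rho> y) differentiable (at x within {\<xi>..})"
      using L x zero_less_one unfolding solves_fokker_planck_def by blast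
    then show "((\<lambda>y. D1 y * \<rho> y) has_real_derivative D2 x * \<rho> x) (at x within {\<xi>..})"
      using zero[OF x]
      by (simp add: flux_def vector_derivative_works has_real_derivative_iff_has_vector_derivative)
  qed
next
  assume R: ?R
  have zero: "flux D1 D2 \<xi> (\<lambda>x \<tau>. \<rho> x) x \<tau> = 0" if "x \<ge> \<xi>" for x \<tau>
    using R that vector_derivative_within[OF at_within_atLeast_neq_bot]
    by (fastforce simp: flux_def has_real_derivative_iff_has_vector_derivative)
  \<comment> \<open>The flux agrees with the zero function on the whole half-line, and a derivative
    within the half-line depends on no other points.\<close>
  have J: "((\<lambda>y. flux D1 D2 \<xi> (\<lambda>x \<tau>. \<rho> x) y \<tau>) has_vector_derivative 0) (at x within {\<xi>..})"
    if "x \<ge> \<xi>" for x \<tau>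
    by (rule has_vector_derivative_transform[where f="\<lambda>_. 0"]) (use that zero in auto)
  show ?L
    unfolding solves_fokker_planck_def
  proof (intro allI impI conjI)
    fix \<tau> x :: real assume x: "x \<ge> \<xi>"
    show "(\<lambda>y. D1 y * \<rho> y) differentiable (at x within {\<xi>..})"
      using R x real_differentiable_def by blast
    show "(\<lambda>y. flux D1 D2 \<xi> (\<lambda>x \<tau>. \<rho> x) y \<tau>) differentiable (at x within {\<xi>..})"
      using J[OF x] by (rule differentiableI_vector)
    show "((\<lambda>t. \<rho> x) has_vector_derivative
        - vector_derivative (\<lambda>y. flux D1 D2 \<xi> (\<lambda>x \<tau>. \<rho> x) y \<tau>) (at x within {\<xi>..})) (at \<tau>)"
      using vector_derivative_within[OF at_within_atLeast_neq_bot[OF x] J[OF x]] by simp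
  qed (use zero in simp)
qed

text \<open>With \<open>g = D1 * \<rho>\<close>, that is \<open>\<rho> = 4 * x * g / S\<close>, the
  equation reads \<open>g' = (2*b2/S + b4/(S*x)) * g\<close>, solved by the multiples of
  \<open>x powr (b4/S) * exp (2*b2/S * x)\<close>. Returning from \<open>g\<close> to
  \<open>\<rho>\<close> contributes the extra power of \<open>x\<close>.\<close>

lemma zero_flux_iff:
  fixes S b2 b4 \<xi> :: real
  assumes "S > 0" "\<xi> > 0"
  shows "(\<forall>x\<ge>\<xi>. ((\<lambda>y. 1/2 * (S / (2*y)) * \<rho> y) has_real_derivative
                  (b2 / (2*x) + b4 / (4*x\<^sup>2)) * \<rho> x) (at x within {\<xi>..})) \<longleftrightarrow>
     (\<exists>K. \<forall>x\<ge>\<xi>. \<rho> x = K * x powr (1 + b4/S) * exp (2*b2/S * x))" (is "?L \<longleftrightarrow> ?R")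
proof
  let ?g = "\<lambda>y. 1/2 * (S / (2*y)) * \<rho> y"
  \<comment> \<open>the quotient of \<open>D1 \<rho>\<close> by the explicit solution\<close>
  let ?h = "\<lambda>y. ?g y * y powr (- b4/S) * exp (- (2*b2/S) * y)"
  assume L: ?L
  have "(?h has_real_derivative 0) (at x within {\<xi>..})" if "x \<in> {\<xi>..}" for x
  proof -
    have x: "x \<ge> \<xi>" "x > 0" using that assms by auto
    have g: "(?g has_real_derivative (b2 / (2*x) + b4 / (4*x\<^sup>2)) * \<rho> x) (at x within {\<xi>..})"
      using L x by blast
    have p: "((\<lambda>y. y powr (- b4/S)) has_real_derivative (- b4/S) * x powr (- b4/S - 1)) (at x within {\<xi>..})"
      using x(2) by (rule has_real_derivative_powr[THEN has_field_derivative_at_within])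
    have e: "((\<lambda>y. exp (- (2*b2/S) * y)) has_real_derivative - (2*b2/S) * exp (- (2*b2/S) * x)) (at x within {\<xi>..})"
      using assms(1) by (auto intro!: derivative_eq_intros)
    have deriv: "(?h has_real_derivative
       ((b2 / (2*x) + b4 / (4*x\<^sup>2)) * \<rho> x * x powr (- b4/S)
         + (- b4/S) * x powr (- b4/S - 1) * ?g x) * exp (- (2*b2/S) * x)
       + - (2*b2/S) * exp (- (2*b2/S) * x) * (?g x * x powr (- b4/S))) (at x within {\<xi>..})"
      by (rule DERIV_mult[OF DERIV_mult[OF g p] e])
    have shift: "x powr (- b4/S - 1) = x powr (- b4/S) / x"
      using x by (simp add: powr_diff)
    \<comment> \<open>The power, the exponential and the value of \<open>\<rho>\<close> are replaced
      by free \<open>A\<close>, \<open>E\<close>, \<open>R\<close>, so that only a rational identity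
      in \<open>x\<close> remains.\<close>
    have zero: "((b2 / (2*x) + b4 / (4*x\<^sup>2)) * R * A
         + (- b4/S) * (A / x) * (1/2 * (S / (2*x)) * R)) * E
         + - (2*b2/S) * E * (1/2 * (S / (2*x)) * R * A) = 0" for A E R
      using x assms by (simp add: field_simps power2_eq_square)
    show ?thesis
      using deriv unfolding shift zero .
  qed
  then obtain c where c: "\<forall>x\<in>{\<xi>..}. ?h x = c"
    using has_field_derivative_zero_constant[of "{\<xi>..}" ?h] by auto
  \<comment> \<open>The factor \<open>4 / S\<close>, with one power of \<open>x\<close>, comes from
    division by \<open>D1 x = S / (4 * x)\<close>.\<close>
  have "\<rho> x = (4 * c / S) * x powr (1 + b4/S) * exp (2*b2/S * x)" if "x \<ge> \<xi>" for x
  proof -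
    have "x > 0" using that assms by simp
    then have "x powr (1 + b4/S) = x * x powr (b4/S)"
      by (simp add: powr_add)
    moreover have "c = ?h x" using c that by simp
    ultimately show ?thesis
      using \<open>x > 0\<close> assms by (simp add: powr_minus exp_minus field_simps)
  qed
  then show ?R by blast
next
  assume ?R
  then obtain K where K: "\<And>x. x \<ge> \<xi> \<Longrightarrow> \<rho> x = K * x powr (1 + b4/S) * exp (2*b2/S * x)"
    by blast
  show ?L
  proof (intro allI impI)
    fix x assume x: "x \<ge> \<xi>"
    then have "x > 0" using assms by simp
    \<comment> \<open>This is the product \<open>D1 * \<rho>\<close> after cancelling one factor
      \<open>y\<close>; the two agree on \<open>{\<xi>..}\<close>, which suffices for a derivative
      within that set.\<close>
    let ?G = "\<lambda>y. S/4 * K * y powr (b4/S) * exp (2*b2/S * y)"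
    have "(?G has_real_derivative S/4 * K * (b4/S * x powr (b4/S - 1)) * exp (2*b2/S * x)
        + S/4 * K * x powr (b4/S) * (exp (2*b2/S * x) * (2*b2/S))) (at x within {\<xi>..})"
    proof -
      have p: "((\<lambda>y. y powr (b4/S)) has_real_derivative b4/S * x powr (b4/S - 1)) (at x within {\<xi>..})"
        using \<open>x > 0\<close> by (rule has_real_derivative_powr[THEN has_field_derivative_at_within])
      have e: "((\<lambda>y. exp (2*b2/S * y)) has_real_derivative 2*b2/S * exp (2*b2/S * x)) (at x within {\<xi>..})"
        using assms(1) by (auto intro!: derivative_eq_intros)
      show ?thesis
        using DERIV_mult[OF DERIV_cmult[OF p, of "S/4 * K"] e] by (simp add: mult_ac)
    qed
    moreover have "S/4 * K * (b4/S * x powr (b4/S - 1)) * exp (2*b2/S * x)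
        + S/4 * K * x powr (b4/S) * (exp (2*b2/S * x) * (2*b2/S))
        = (b2 / (2*x) + b4 / (4*x\<^sup>2)) * \<rho> x"
    proof -
      have p: "x powr (b4/S - 1) = x powr (b4/S) / x" "x powr (1 + b4/S) = x * x powr (b4/S)"
        using \<open>x > 0\<close> by (simp_all add: powr_diff powr_add)
      have "S/4 * K * (b4/S * (A / x)) * E + S/4 * K * A * (E * (2*b2/S))
        = (b2 / (2*x) + b4 / (4*x\<^sup>2)) * (K * (x * A) * E)" for A E
        using \<open>x > 0\<close> assms by (simp add: field_simps power2_eq_square)
      then show ?thesis unfolding K[OF x] p .
    qed
    ultimately have deriv: "(?G has_real_derivative (b2 / (2*x) + b4 / (4*x\<^sup>2)) * \<rho> x) (at x within {\<xi>..})"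
      by simp
    have G: "1/2 * (S / (2*y)) * \<rho> y = ?G y" if "y \<in> {\<xi>..}" for y
      using that assms K[of y] by (simp add: powr_add)
    show "((\<lambda>y. 1/2 * (S / (2*y)) * \<rho> y) has_real_derivative
                  (b2 / (2*x) + b4 / (4*x\<^sup>2)) * \<rho> x) (at x within {\<xi>..})"
      using has_vector_derivative_transform[OF _ G deriv[unfolded has_real_derivative_iff_has_vector_derivative]] x
      by (simp add: has_real_derivative_iff_has_vector_derivative)
  qed
qed

section \<open>The substitution x = s^2/2 on half-lines\<close>

text \<open>Continuity from below of the measure \<open>density lborel f\<close> along the
  exhausting intervals. It carries substitution from compact intervals to half-lines.\<close>

lemma nn_integral_atLeast_eq_SUP:
  fixes f :: "real \<Rightarrow> ennreal" and b :: "nat \<Rightarrow> real"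
  assumes [measurable]: "f \<in> borel_measurable borel"
    and "incseq b" "filterlim b at_top sequentially"
  shows "(\<integral>\<^sup>+x. f x * indicator {a..} x \<partial>lborel) = (SUP n. \<integral>\<^sup>+x. f x * indicator {a..b n} x \<partial>lborel)"
proof -
  have "(\<Union>n. {a..b n}) = {a..}"
    using assms(3) by (fastforce simp: filterlim_at_top eventually_sequentially)
  moreover have "incseq (\<lambda>n. {a..b n})"
    using assms(2) by (fastforce simp: incseq_def)
  ultimately have "(SUP n. emeasure (density lborel f) {a..b n}) = emeasure (density lborel f) {a..}"
    using SUP_emeasure_incseq[of "\<lambda>n. {a..b n}" "density lborel f"] by (simp add: image_subset_iff)
  then show ?thesis
    by (simp add: emeasure_density)
qed

lemma nn_integral_half_square_substitution:
  fixes h :: "real \<Rightarrow> ennreal" and a :: real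
  assumes [measurable]: "h \<in> borel_measurable borel" and "a \<ge> 0"
  shows "(\<integral>\<^sup>+x. h x * indicator {a\<^sup>2/2..} x \<partial>lborel) =
         (\<integral>\<^sup>+s. h (s\<^sup>2/2) * ennreal s * indicator {a..} s \<partial>lborel)"
proof -
  \<comment> \<open>\<open>Suc n\<close> rather than \<open>n\<close> keeps every interval
    nondegenerate, as substitution on \<open>{a..?b n}\<close> demands.\<close>
  let ?b = "\<lambda>n. a + real (Suc n)"
  have "(\<integral>\<^sup>+x. h x * indicator {a\<^sup>2/2..} x \<partial>lborel) =
        (SUP n. \<integral>\<^sup>+x. h x * indicator {a\<^sup>2/2..(?b n)\<^sup>2/2} x \<partial>lborel)"
  proof (rule nn_integral_atLeast_eq_SUP)
    show "incseq (\<lambda>n. (?b n)\<^sup>2/2)"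
      using assms(2) by (auto simp: incseq_def intro!: power_mono)
    show "filterlim (\<lambda>n. (?b n)\<^sup>2/2) at_top sequentially"
      by real_asymp
  qed simp
  also have "\<dots> = (SUP n. \<integral>\<^sup>+s. h (s\<^sup>2/2) * ennreal s * indicator {a..?b n} s \<partial>lborel)"
    using assms(2)
    by (intro SUP_cong refl nn_integral_substitution_aux[where g="\<lambda>s. s\<^sup>2/2" and g'="\<lambda>s. s"])
       (auto intro!: derivative_eq_intros continuous_intros)
  also have "\<dots> = (\<integral>\<^sup>+s. h (s\<^sup>2/2) * ennreal s * indicator {a..} s \<partial>lborel)"
  proof (rule nn_integral_atLeast_eq_SUP[symmetric])
    show "incseq ?b" by (auto simp: incseq_def)
    show "filterlim ?b at_top sequentially" by real_asymp
  qed measurable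
  finally show ?thesis .
qed

text \<open>Since \<open>X\<close> is nonnegative, it is recovered from \<open>X^2/2\<close> by the
  map \<open>sqrt (2 * x)\<close>; its law is therefore an image of the known one, and the
  substitution turns that image into a density.\<close>

lemma distributed_of_half_square:
  fixes X :: "'a \<Rightarrow> real" and f :: "real \<Rightarrow> real"
  assumes dist: "distributed M lborel (\<lambda>p. (X p)\<^sup>2/2) (\<lambda>x. ennreal (indicator {a\<^sup>2/2..} x * f x))"
    and X[measurable]: "X \<in> borel_measurable M" and nonneg: "\<And>p. 0 \<le> X p" and "a \<ge> 0"
  shows "distributed M lborel X (\<lambda>s. ennreal (indicator {a..} s * (s * f (s\<^sup>2/2))))"
proof -
  let ?f = "\<lambda>x. ennreal (indicator {a\<^sup>2/2..} x * f x)"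
  let ?g = "\<lambda>s. ennreal (indicator {a..} s * (s * f (s\<^sup>2/2)))"
  have [measurable]: "?f \<in> borel_measurable borel"
    and law: "distr M lborel (\<lambda>p. (X p)\<^sup>2/2) = density lborel ?f"
    using dist by (auto simp: distributed_def)
  \<comment> \<open>Measurability is known for the truncated density \<open>?f\<close>, so
    \<open>?g\<close> is expressed through it.\<close>
  have g: "?g s = ?f (s\<^sup>2/2) * ennreal s * indicator {a..} s" for s
    using assms(4) by (auto simp: indicator_def ennreal_mult' mult.commute)
  have [measurable]: "?g \<in> borel_measurable borel"
    unfolding g by measurable
  have "distr M lborel X = density lborel ?g"
  proof (rule measure_eqI)
    fix A assume "A \<in> sets (distr M lborel X)"
    then have [measurable]: "A \<in> sets borel" by simp
    have "distr M lborel X = distr (distr M lborel (\<lambda>p. (X p)\<^sup>2/2)) lborel (\<lambda>x. sqrt (2 * x))"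
      using nonneg by (subst distr_distr) (auto simp: comp_def)
    then have "emeasure (distr M lborel X) A
        = (\<integral>\<^sup>+y. indicator A y \<partial>distr (density lborel ?f) lborel (\<lambda>x. sqrt (2 * x)))"
      by (simp add: law)
    also have "\<dots> = (\<integral>\<^sup>+x. indicator A (sqrt (2 * x)) \<partial>density lborel ?f)"
      by (rule nn_integral_distr) measurable
    also have "\<dots> = (\<integral>\<^sup>+x. ?f x * indicator A (sqrt (2 * x)) \<partial>lborel)"
      by (rule nn_integral_density) measurable
    \<comment> \<open>The second indicator changes nothing, as \<open>?f\<close> already vanishes
      outside the half-line; it produces the shape required by the substitution.\<close>
    also have "\<dots> = (\<integral>\<^sup>+x. ?f x * indicator A (sqrt (2 * x)) * indicator {a\<^sup>2/2..} x \<partial>lborel)"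
      by (intro nn_integral_cong) (auto simp: indicator_def)
    also have "\<dots> = (\<integral>\<^sup>+s. ?f (s\<^sup>2/2) * indicator A (sqrt (2 * (s\<^sup>2/2))) * ennreal s * indicator {a..} s \<partial>lborel)"
      by (rule nn_integral_half_square_substitution) (use assms(4) in measurable)
    also have "\<dots> = (\<integral>\<^sup>+s. ?g s * indicator A s \<partial>lborel)"
      unfolding g using assms(4) by (intro nn_integral_cong) (auto simp: indicator_def)
    also have "\<dots> = emeasure (density lborel ?g) A"
      by (simp add: emeasure_density)
    finally show "emeasure (distr M lborel X) A = emeasure (density lborel ?g) A" .
  qed simp
  then show ?thesis
    using X by (simp add: distributed_def)
qed

section \<open>Normalisation of the stationary density\<close>

text \<open>The equation leaves a single free factor \<open>K\<close>, and total mass one reads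
  \<open>K * I = 1\<close> with \<open>I\<close> the integral of the unnormalised profile. The sign
  of \<open>b2\<close> makes \<open>I\<close> finite. As \<open>N\<close> precedes the quantifier
  over \<open>\<rho>\<close>, existence and uniqueness on \<open>{\<xi>..}\<close> are both
  expressed.\<close>

lemma stationary_density_explicit:
  fixes S b2 b4 \<xi> :: real
  assumes "S > 0" "b2 < 0" "\<xi> > 0"
  shows "\<exists>N>0. \<forall>\<rho>. stationary_density (\<lambda>x. 1/2 * (S / (2*x))) (\<lambda>x. b2 / (2*x) + b4 / (4*x\<^sup>2)) \<xi> \<rho> \<longleftrightarrow>
     (\<forall>x\<ge>\<xi>. \<rho> x = N * x powr (1 + b4/S) * exp (2*b2/S * x))"
proof -
  let ?w = "\<lambda>x. x powr (1 + b4/S) * exp (2*b2/S * x)"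
  define I where "I = (LBINT x:{\<xi>..}. ?w x)"
  have w: "set_integrable lborel {\<xi>..} ?w"
    using assms by (intro set_integrable_powr_exp_atLeast) (auto simp: divide_neg_pos)
  have I: "I > 0"
    unfolding I_def using w assms(3) by (intro set_integral_pos_atLeast) auto
  have density: "prob_density_on {\<xi>..} \<rho> \<longleftrightarrow> K = 1 / I" if \<rho>: "\<And>x. x \<ge> \<xi> \<Longrightarrow> \<rho> x = K * x powr (1 + b4/S) * exp (2*b2/S * x)" for \<rho> K
  proof -
    have "set_integrable lborel {\<xi>..} \<rho>"
      using set_integrable_mult_right[OF w, of K] \<rho> by (subst set_integrable_cong[OF refl refl]) (auto simp: mult.assoc)
    moreover have "(LBINT x:{\<xi>..}. \<rho> x) = (LBINT x:{\<xi>..}. K * ?w x)"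
      using \<rho> by (intro set_lebesgue_integral_cong) (auto simp: mult.assoc)
    then have "(LBINT x:{\<xi>..}. \<rho> x) = K * I"
      by (simp add: I_def)
    moreover have "\<forall>x\<in>{\<xi>..}. 0 \<le> \<rho> x" if "K = 1 / I"
      using \<rho> that I by simp
    ultimately show ?thesis
      using I by (auto simp: prob_density_on_def field_simps)
  qed
  have "stationary_density (\<lambda>x. 1/2 * (S / (2*x))) (\<lambda>x. b2 / (2*x) + b4 / (4*x\<^sup>2)) \<xi> \<rho> \<longleftrightarrow>
     (\<forall>x\<ge>\<xi>. \<rho> x = 1 / I * x powr (1 + b4/S) * exp (2*b2/S * x))" for \<rho>
    unfolding stationary_density_def stationary_solution_iff_zero_flux zero_flux_iff[OF assms(1,3)]
    using density[of \<rho>] by blast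
  then show ?thesis
    using I by (intro exI[of _ "1 / I"]) simp
qed

section \<open>Speed densities per collision and per unit time\<close>

lemma half_square_powr_exp:
  fixes s p k N :: real
  assumes "s > 0"
  shows "s * (N * (s\<^sup>2/2) powr p * exp (- (s\<^sup>2/2) / k))
       = N / 2 powr p * s powr (2*p + 1) * exp (- s\<^sup>2 / (2*k))"
proof -
  have "(s\<^sup>2/2) powr p = s powr (2*p) / 2 powr p"
    using assms by (simp add: powr_divide powr_powr flip: powr_numeral)
  then show ?thesis
    using assms by (simp add: powr_add mult.commute)
qed

text \<open>The same substitution at the level of densities alone, so that normalisation of the
  speed density does not rest on a given momentum law.\<close>

lemma prob_density_on_half_square:
  fixes f :: "real \<Rightarrow> real"
  assumes [measurable]: "f \<in> borel_measurable borel" and "prob_density_on {a\<^sup>2/2..} f" "a \<ge> 0"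
  shows "prob_density_on {a..} (\<lambda>s. s * f (s\<^sup>2/2))"
proof -
  have nonneg: "0 \<le> f x" if "x \<ge> a\<^sup>2/2" for x
    using assms(2) that by (simp add: prob_density_on_def)
  have sq: "a\<^sup>2 \<le> s\<^sup>2" if "s \<ge> a" for s
    using that assms(3) by (simp add: power_mono)
  have "(\<integral>\<^sup>+s. ennreal (indicator {a..} s * (s * f (s\<^sup>2/2))) \<partial>lborel)
      = (\<integral>\<^sup>+s. ennreal (f (s\<^sup>2/2)) * ennreal s * indicator {a..} s \<partial>lborel)"
    using assms(3) by (intro nn_integral_cong) (auto simp: indicator_def ennreal_mult' mult.commute)
  also have "\<dots> = (\<integral>\<^sup>+x. ennreal (f x) * indicator {a\<^sup>2/2..} x \<partial>lborel)"
    using assms(3) by (intro nn_integral_half_square_substitution[symmetric]) auto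
  also have "\<dots> = (\<integral>\<^sup>+x. ennreal (indicator {a\<^sup>2/2..} x * f x) \<partial>lborel)"
    by (intro nn_integral_cong) (auto simp: indicator_def)
  also have "\<dots> = 1"
    using assms(2) nonneg by (subst (asm) prob_density_on_iff_nn_integral) auto
  finally show ?thesis
    using nonneg sq assms(3) by (subst prob_density_on_iff_nn_integral) auto
qed

text \<open>The factor \<open>lstar\<close> cancels between numerator and normalising integral. That
  integral is finite because \<open>f s / s\<close> is at most \<open>f s / a\<close> for
  \<open>s \<ge> a > 0\<close>.\<close>

lemma time_density_explicit:
  fixes f :: "real \<Rightarrow> real"
  assumes "lstar > 0" "a > 0" and [measurable]: "f \<in> borel_measurable borel"
    and "prob_density_on {a..} f" and pos: "\<And>s. s \<ge> a \<Longrightarrow> 0 < f s"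
  shows "\<exists>c>0. (\<forall>s. time_density lstar a f s = c * (f s / s)) \<and> prob_density_on {a..} (\<lambda>s. c * (f s / s))"
proof -
  define J where "J = (LBINT s:{a..}. f s / s)"
  have "set_integrable lborel {a..} (\<lambda>s. 1/a * f s)"
    using assms(4) by (intro set_integrable_mult_right) (simp add: prob_density_on_def)
  then have int: "set_integrable lborel {a..} (\<lambda>s. f s / s)"
  proof (rule set_integrable_bound)
    show "set_borel_measurable lborel {a..} (\<lambda>s. f s / s)"
      unfolding set_borel_measurable_def by measurable
    have "norm (f s / s) \<le> norm (1/a * f s)" if "s \<ge> a" for s
      using that assms(2) pos[OF that] by (simp add: frac_le)
    then show "AE s in lborel. s \<in> {a..} \<longrightarrow> norm (f s / s) \<le> norm (1/a * f s)"
      by auto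
  qed
  have J: "J > 0"
    unfolding J_def using int assms(2) pos by (intro set_integral_pos_atLeast) auto
  have "(LBINT s:{a..}. lstar / s * f s) = lstar * J"
    unfolding J_def by (subst set_integral_mult_right[symmetric]) (simp add: mult.commute)
  then have "time_density lstar a f s = 1/J * (f s / s)" for s
    using assms(1) by (simp add: time_density_def)
  moreover have "prob_density_on {a..} (\<lambda>s. 1/J * (f s / s))"
    unfolding prob_density_on_def
  proof (intro conjI ballI)
    show "0 \<le> 1/J * (f s / s)" if "s \<in> {a..}" for s
      using that J assms(2) pos[of s] by simp
    show "set_integrable lborel {a..} (\<lambda>s. 1/J * (f s / s))"
      by (rule set_integrable_mult_right) (rule int)
    have "(LBINT s:{a..}. 1/J * (f s / s)) = 1/J * J"
      unfolding J_def by (rule set_integral_mult_right)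
    then show "(LBINT s:{a..}. 1/J * (f s / s)) = 1" using J by simp
  qed
  ultimately show ?thesis
    using J by (intro exI[of _ "1/J"]) simp
qed

section \<open>The physical constants and the resulting densities\<close>

text \<open>This covers non-integrable \<open>f\<close> too, whose integral is \<open>0\<close> by
  convention.\<close>

lemma bar_nonneg:
  assumes "\<And>b Q P. 0 \<le> f b Q P"
  shows "0 \<le> bar e M U \<rho>hat f"
  unfolding bar_def using assms by (intro integral_nonneg_AE) auto

theorem mainTheorem2:
  fixes \<sigma> :: "real ^ 'n \<Rightarrow> real" and e :: "real ^ 'n"
    and U \<rho>hat :: "real \<Rightarrow> real" and M lstar r c \<xi> :: real
  defines "d \<equiv> real CARD('n)"
    and "S \<equiv> Sigma1_sq \<sigma> e M U \<rho>hat"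
    and "\<beta>2 \<equiv> delta_beta2 \<sigma> e M U \<rho>hat"
    and "\<beta>4 \<equiv> delta_beta4 \<sigma> e M U \<rho>hat"
    and "k2 \<equiv> kscatt_sq e M U \<rho>hat"
    and "C \<equiv> C_const \<sigma> e M U \<rho>hat"
  defines "D1 \<equiv> (\<lambda>x. 1 / 2 * (S / (2 * x)))"
    and "D2 \<equiv> (\<lambda>x. \<beta>2 / (2 * x) + \<beta>4 / (4 * x\<^sup>2))"
  assumes dim: "CARD('n) \<ge> 2"
    and M_pos: "M > 0" and l_pos: "lstar > 0"
    and sigma_measurable: "\<sigma> \<in> borel_measurable borel"
    and sigma_rot: "rotation_invariant \<sigma>"
    and sigma_supp: "compact (closure {x. \<sigma> x \<noteq> 0})" "closure {x. \<sigma> x \<noteq> 0} \<subseteq> ball 0 (1/2)"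
    and sigma_bound: "\<forall>x. \<bar>\<sigma> x\<bar> \<le> 1"
    and U_smooth: "smooth_fun U"
    and U_confining: "filterlim U at_top at_infinity"
    and U_growth: "r \<ge> 1" "c > 0" "U \<sim>[at_infinity] (\<lambda>Q. c * \<bar>Q\<bar> powr r)"
    and bath_measurable: "bath_density M U \<rho>hat \<in> borel_measurable borel"
    and bath_nonneg: "\<forall>qp. bath_density M U \<rho>hat qp \<ge> 0"
    and bath_prob: "prob_space (bath_law M U \<rho>hat)"
    and bath_supp: "compact (closure {qp. bath_density M U \<rho>hat qp \<noteq> 0})"
    and e_unit: "norm e = 1"
    and Sigma1_pos: "S > 0"
    and xi_pos: "\<xi> > 0"
  shows "\<exists>N Nt N'. N > 0 \<and> Nt > 0 \<and> N' > 0 \<and>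
     (\<forall>\<rho>. stationary_density D1 D2 \<xi> \<rho> \<longleftrightarrow>
        (\<forall>x\<ge>\<xi>. \<rho> x = N * x powr (1 + \<beta>4 / S) * exp (2 * \<beta>2 / S * x))) \<and>
     (\<forall>x\<ge>\<xi>. N * x powr (1 + \<beta>4 / S) * exp (2 * \<beta>2 / S * x)
            = N * x powr ((d - 1) / 2 + C / k2) * exp (- x / k2)) \<and>
     (\<forall>\<rho> (Law :: (real ^ 'n) measure).
        stationary_density D1 D2 \<xi> \<rho> \<and> prob_space Law \<and> sets Law = sets borel \<and>
        distributed Law lborel (\<lambda>p. (norm p)\<^sup>2 / 2) (\<lambda>x. ennreal (indicator {\<xi>..} x * \<rho> x)) \<longrightarrow>
        distributed Law lborel norm
          (\<lambda>s. ennreal (indicator {sqrt (2 * \<xi>)..} s *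
                        (Nt * s powr (d + 2 * C / k2) * exp (- s\<^sup>2 / (2 * k2)))))) \<and>
     prob_density_on {sqrt (2 * \<xi>)..}
       (\<lambda>s. Nt * s powr (d + 2 * C / k2) * exp (- s\<^sup>2 / (2 * k2))) \<and>
     (\<forall>s\<ge>sqrt (2 * \<xi>).
        time_density lstar (sqrt (2 * \<xi>))
          (\<lambda>s. Nt * s powr (d + 2 * C / k2) * exp (- s\<^sup>2 / (2 * k2))) s
        = N' * s powr (d - 1 + 2 * C / k2) * exp (- s\<^sup>2 / (2 * k2))) \<and>
     prob_density_on {sqrt (2 * \<xi>)..}
       (\<lambda>s. N' * s powr (d - 1 + 2 * C / k2) * exp (- s\<^sup>2 / (2 * k2)))"
proof -
  have "mean_P2 e M U \<rho>hat \<ge> 0" "mean_L02 \<sigma> e M U \<rho>hat \<ge> 0"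
    by (auto simp: mean_P2_def mean_L02_def intro: bar_nonneg)
  \<comment> \<open>\<open>S\<close> is a positive multiple of the product of these two nonnegative
    means, so \<open>S > 0\<close> excludes the value zero for both.\<close>
  then have P2: "mean_P2 e M U \<rho>hat > 0" and L2: "mean_L02 \<sigma> e M U \<rho>hat > 0"
    using Sigma1_pos by (auto simp: S_def Sigma1_sq_def less_le)
  have k2: "k2 > 0"
    using P2 M_pos by (simp add: k2_def kscatt_sq_def)
  have \<beta>2: "\<beta>2 < 0"
    using L2 by (simp add: \<beta>2_def delta_beta2_def)
  define p where "p = (d - 1) / 2 + C / k2"
  \<comment> \<open>\<open>S\<close> cancels, and \<open>k2 = mean_P2 / M\<close> turns the second
    summand of \<open>\<beta>4 / S\<close> into \<open>C / k2\<close>; then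
    \<open>1 + (d - 3)/2 = (d - 1)/2\<close>.\<close>
  have exponent: "1 + \<beta>4 / S = p"
  proof -
    have "\<beta>4 / S = (d - 3) / 2 + C / k2"
      using Sigma1_pos P2 M_pos
      by (simp add: S_def \<beta>4_def d_def delta_beta4_def C_def C_const_def k2_def kscatt_sq_def mult_ac)
    then show ?thesis by (simp add: p_def field_simps)
  qed
  \<comment> \<open>The mean of \<open>L0^2\<close> cancels and leaves
    \<open>- M / mean_P2\<close>.\<close>
  have rate: "2 * \<beta>2 / S = - 1 / k2"
    using P2 L2 M_pos
    by (simp add: S_def \<beta>2_def delta_beta2_def Sigma1_sq_def k2_def kscatt_sq_def)
  have eq: "N * x powr (1 + \<beta>4 / S) * exp (2 * \<beta>2 / S * x) = N * x powr p * exp (- x / k2)" for N x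
    unfolding exponent rate by simp
  obtain N where N: "N > 0"
    and stat: "\<And>\<rho>. stationary_density D1 D2 \<xi> \<rho> \<longleftrightarrow>
        (\<forall>x\<ge>\<xi>. \<rho> x = N * x powr (1 + \<beta>4 / S) * exp (2 * \<beta>2 / S * x))"
    using stationary_density_explicit[OF Sigma1_pos \<beta>2 xi_pos, of \<beta>4] unfolding D1_def D2_def by blast
  let ?a = "sqrt (2 * \<xi>)"
  let ?\<rho> = "\<lambda>x. N * x powr p * exp (- x / k2)"
  have a: "?a > 0" "?a\<^sup>2 / 2 = \<xi>"
    using xi_pos by auto
  have s_pos: "s > 0" if "s \<ge> ?a" for s
    using a(1) that by (rule less_le_trans)
  \<comment> \<open>The factor \<open>2 powr p\<close> comes from
    \<open>(s^2/2) powr p\<close>.\<close>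
  define Nt where "Nt = N / 2 powr p"
  define f where "f = (\<lambda>s. Nt * s powr (d + 2 * C / k2) * exp (- s\<^sup>2 / (2 * k2)))"
  have Nt: "Nt > 0"
    using N by (simp add: Nt_def)
  have f_eq: "s * ?\<rho> (s\<^sup>2/2) = f s" if "s > 0" for s
  proof -
    \<comment> \<open>Squaring doubles the exponent \<open>p\<close>, and the Jacobian
      \<open>s\<close> adds one.\<close>
    have "2 * p + 1 = d + 2 * C / k2"
      by (simp add: p_def field_simps)
    then show ?thesis
      using half_square_powr_exp[OF that, of N p k2] by (simp add: f_def Nt_def)
  qed
  have f_meas: "f \<in> borel_measurable borel"
    unfolding f_def by measurable
  have f_pos: "0 < f s" if "s \<ge> ?a" for s
  proof -
    have "s > 0" using that by (rule s_pos)
    then show ?thesis using Nt by (simp add: f_def)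
  qed
  have stat': "stationary_density D1 D2 \<xi> \<rho> \<longleftrightarrow> (\<forall>x\<ge>\<xi>. \<rho> x = ?\<rho> x)" for \<rho>
    using stat unfolding eq .
  \<comment> \<open>The characterisation applied to the explicit profile itself shows that it is
    normalised.\<close>
  have "prob_density_on {\<xi>..} ?\<rho>"
    using stat'[of ?\<rho>] unfolding stationary_density_def by blast
  then have "prob_density_on {?a..} (\<lambda>s. s * ?\<rho> (s\<^sup>2/2))"
    using a by (intro prob_density_on_half_square) auto
  moreover have "prob_density_on {?a..} (\<lambda>s. s * ?\<rho> (s\<^sup>2/2)) \<longleftrightarrow> prob_density_on {?a..} f"
  proof -
    have "s * ?\<rho> (s\<^sup>2/2) = f s" if "s \<in> {?a..}" for s
      using that s_pos by (intro f_eq) simp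
    then show ?thesis
      by (intro prob_density_on_cong) auto
  qed
  ultimately have f_density: "prob_density_on {?a..} f" by blast
  obtain c where c: "c > 0" "\<And>s. time_density lstar ?a f s = c * (f s / s)"
    "prob_density_on {?a..} (\<lambda>s. c * (f s / s))"
    using time_density_explicit[OF l_pos a(1) f_meas f_density f_pos] by blast
  have quotient: "c * (f s / s) = c * Nt * s powr (d - 1 + 2 * C / k2) * exp (- s\<^sup>2 / (2 * k2))"
    if "s \<ge> ?a" for s
  proof -
    have "s > 0" using that by (rule s_pos)
    then have "s powr (d + 2 * C / k2) = s powr (d - 1 + 2 * C / k2) * s"
      by (simp add: powr_mult_base algebra_simps flip: powr_add)
    then show ?thesis using \<open>s > 0\<close> by (simp add: f_def)
  qed
  have speed: "distributed Law lborel norm (\<lambda>s. ennreal (indicator {?a..} s * f s))"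
    if stat\<rho>: "stationary_density D1 D2 \<xi> \<rho>" and Law: "sets Law = sets borel"
      and dist: "distributed Law lborel (\<lambda>p. (norm p)\<^sup>2 / 2) (\<lambda>x. ennreal (indicator {\<xi>..} x * \<rho> x))"
    for \<rho> and Law :: "(real ^ 'n) measure"
  proof -
    \<comment> \<open>Below \<open>\<xi>\<close> the function \<open>\<rho>\<close> is arbitrary,
      but the indicator removes those values, so the two densities agree everywhere.\<close>
    have "(\<lambda>x. ennreal (indicator {\<xi>..} x * \<rho> x)) = (\<lambda>x. ennreal (indicator {?a\<^sup>2/2..} x * ?\<rho> x))"
      using stat\<rho> stat'[of \<rho>] a(2) by (auto simp: indicator_def)
    moreover have "norm \<in> borel_measurable Law"
      using Law by (subst measurable_cong_sets[OF Law refl]) simp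
    ultimately have speed: "distributed Law lborel norm (\<lambda>s. ennreal (indicator {?a..} s * (s * ?\<rho> (s\<^sup>2/2))))"
      using dist a(1) by (intro distributed_of_half_square) auto
    have "indicator {?a..} s * (s * ?\<rho> (s\<^sup>2/2)) = indicator {?a..} s * f s" for s
      using f_eq[OF s_pos, of s] by (simp add: indicator_def)
    with speed show ?thesis by (simp only:)
  qed
  have time: "time_density lstar ?a f s = c * Nt * s powr (d - 1 + 2 * C / k2) * exp (- s\<^sup>2 / (2 * k2))"
    if "s \<ge> ?a" for s
    using c(2) quotient[OF that] by simp
  have time_prob: "prob_density_on {?a..} (\<lambda>s. c * Nt * s powr (d - 1 + 2 * C / k2) * exp (- s\<^sup>2 / (2 * k2)))"
    using c(3) quotient by (subst prob_density_on_cong[where g="\<lambda>s. c * (f s / s)"]) auto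
  \<comment> \<open>This product is the witness for \<open>N'\<close>: \<open>c\<close> renormalises
    after the weighting by \<open>1/s\<close>.\<close>
  have cNt: "c * Nt > 0"
    using c(1) Nt by simp
  note eq' = eq[unfolded p_def]
    and speed' = speed[unfolded f_def]
    and f_density' = f_density[unfolded f_def]
    and time' = time[unfolded f_def]
  show ?thesis
    by (rule exI[of _ N], rule exI[of _ Nt], rule exI[of _ "c * Nt"], intro conjI allI impI; (elim conjE)?)
       ((rule N Nt cNt stat eq' f_density' time_prob | rule speed' time', assumption+)+)
qed

end
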